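(* Let $G$ be a finite simple triangle-free graph and $\phi$ a proper vertex coloring of $G$. Then for every vertex $v \in V(G)$ there exists an induced path in $G$ starting at $v$ whose vertices receive at least $\frac{\chi(G)}{2}$ distinct colors under $\phi$.
   Context: $\chi(G)$ denotes the chromatic number of $G$. A path is induced if no two nonconsecutive vertices of the path are adjacent in $G$. A path is called $k$-colorful if the set of colors appearing on its vertices has size at least $k$; the claim asserts the existence of an induced $\frac{\chi(G)}{2}$-colorful path starting at $v$.
   Formalization: The graph G is additionally assumed connected; without this the claim fails, e.g. for the disjoint union of a 5-cycle and an isolated vertex v, where χ(G)=3 but the only path starting at v has one color. *)

theory Defs
  imports Complex_Main "Graph_Theory.Graph_Theory"
begin

text \<open>
  A finite simple graph is a digraph satisfying the locale predicate \<^locale>\<open>graph\<close>: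
  finitely many vertices and arcs, no loops, no parallel arcs, and a symmetric adjacency
  relation \<open>u \<rightarrow>\<^bsub>G\<^esub> v\<close>. An undirected edge is thus a pair of opposite arcs.
\<close>

text \<open>In a loop-free graph the three vertices below are automatically distinct.\<close>

definition triangle_free :: "('a, 'b) pre_digraph \<Rightarrow> bool" where
  "triangle_free G \<longleftrightarrow> \<not> (\<exists>u v w. u \<rightarrow>\<^bsub>G\<^esub> v \<and> v \<rightarrow>\<^bsub>G\<^esub> w \<and> w \<rightarrow>\<^bsub>G\<^esub> u)"

definition proper_coloring :: "('a, 'b) pre_digraph \<Rightarrow> ('a \<Rightarrow> 'c) \<Rightarrow> bool" where
  "proper_coloring G \<phi> \<longleftrightarrow> (\<forall>u v. u \<rightarrow>\<^bsub>G\<^esub> v \<longrightarrow> \<phi> u \<noteq> \<phi> v)"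

definition chromatic_number :: "('a, 'b) pre_digraph \<Rightarrow> nat" where
  "chromatic_number G =
     (LEAST k. \<exists>f :: 'a \<Rightarrow> nat. proper_coloring G f \<and> f ` verts G \<subseteq> {..<k})"

definition induced_path :: "('a, 'b) pre_digraph \<Rightarrow> 'a list \<Rightarrow> bool" where
  "induced_path G p \<longleftrightarrow> vpath p G \<and>
     (\<forall>i j. i < length p \<and> j < length p \<and> p ! i \<rightarrow>\<^bsub>G\<^esub> p ! j \<longrightarrow> j = Suc i \<or> i = Suc j)"

end

theory Submission
  imports Defs
begin

text \<open>
  Fix a set \<open>S\<close> of used colors containing the color of \<open>v\<close>, and count only the vertices with colors
  outside \<open>S\<close>. If no induced path from \<open>v\<close> sees more than \<open>k\<close> new colors, then the new-colored
  vertices admit a proper coloring with \<open>2 * k\<close> colors. Indeed, delete \<open>v\<close> and its neighbors. A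
  component \<open>D\<close> of the rest that touches a new-colored neighbor \<open>u\<close> of \<open>v\<close> needs only
  \<open>2 * (k - 1) + 1\<close> colors: continue from \<open>u\<close> with the color of \<open>u\<close> added to \<open>S\<close>, whose color class
  costs one color. A component touching only old-colored neighbors needs \<open>2 * k\<close> colors, by
  continuing from one of these with the same \<open>S\<close>. By triangle-freeness the new-colored neighbors of
  \<open>v\<close> are independent, and the components of the second kind are not adjacent to them, so a single
  color, the last one, serves them all. Starting with just the color of \<open>v\<close> in \<open>S\<close> adds one color
  for its class.
\<close>

lemma induced_path_singleton:
  assumes "graph G" and "v \<in> verts G"
  shows "induced_path G [v]"
proof -
  interpret graph G by fact
  show ?thesis
    using assms(2) adj_not_same by (auto simp: induced_path_def)
qed

text \<open>A new chord would have to leave \<open>v\<close>. By \<open>only\<close> it would end at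
  \<open>hd p\<close>, which, as \<open>p\<close> is distinct, occurs only right after
  \<open>v\<close>.\<close>

lemma induced_path_Cons:
  assumes "graph G" and p: "induced_path G p"
    and adj: "v \<rightarrow>\<^bsub>G\<^esub> hd p" and nin: "v \<notin> set p"
    and only: "\<And>z. z \<in> set p \<Longrightarrow> v \<rightarrow>\<^bsub>G\<^esub> z \<Longrightarrow> z = hd p"
  shows "induced_path G (v # p)"
proof -
  interpret graph G by fact
  have path: "vwalk p G" "distinct p" and ne: "p \<noteq> []"
    using p by (auto simp: induced_path_def vpath_def vwalk_def)
  have vp: "vpath (v # p) G"
    using path nin adj by (auto intro!: vwalk_consI dest: adj_in_verts)
  have hd_index: "i = 0" if "i < length p" "v \<rightarrow>\<^bsub>G\<^esub> p ! i" for i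
    using only[of "p ! i"] that path(2) ne
    by (metis hd_conv_nth length_greater_0_conv nth_eq_iff_index_eq nth_mem)
  have loop: "\<not> v \<rightarrow>\<^bsub>G\<^esub> v"
    using adj_not_same by blast
  have sym: "a \<rightarrow>\<^bsub>G\<^esub> b \<Longrightarrow> b \<rightarrow>\<^bsub>G\<^esub> a" for a b
    by (rule arcs_ends_symmetric[OF sym_arcs])
  have "j = Suc i \<or> i = Suc j"
    if len: "i < length (v # p)" "j < length (v # p)" and ij: "(v # p) ! i \<rightarrow>\<^bsub>G\<^esub> (v # p) ! j" for i j
  proof (cases i)
    case 0
    then show ?thesis
      using len ij loop hd_index by (cases j) auto
  next
    case (Suc i')
    note i = this
    show ?thesis
    proof (cases j)
      case 0
      then have "v \<rightarrow>\<^bsub>G\<^esub> p ! i'"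
        using i ij sym by simp
      then show ?thesis
        using 0 i len(1) hd_index by simp
    next
      case (Suc j')
      then have "i' < length p" "j' < length p" "p ! i' \<rightarrow>\<^bsub>G\<^esub> p ! j'"
        using i len ij by simp_all
      then show ?thesis
        using p Suc i unfolding induced_path_def by blast
    qed
  qed
  then show ?thesis
    using vp by (simp add: induced_path_def)
qed

text \<open>Vertices with colors in \<open>S\<close> stay in \<open>X\<close>, so that paths may run
  through them, but \<open>f\<close> is unconstrained there.\<close>

definition colors_outside ::
  "('a, 'b) pre_digraph \<Rightarrow> ('a \<Rightarrow> 'c) \<Rightarrow> 'c set \<Rightarrow> 'a set \<Rightarrow> nat \<Rightarrow> ('a \<Rightarrow> nat) \<Rightarrow> bool" where
  "colors_outside G \<phi> S X n f \<longleftrightarrow>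
     (\<forall>x \<in> X. \<phi> x \<notin> S \<longrightarrow> f x < n) \<and>
     (\<forall>x \<in> X. \<forall>y \<in> X. \<phi> x \<notin> S \<longrightarrow> \<phi> y \<notin> S \<longrightarrow> x \<rightarrow>\<^bsub>G\<^esub> y \<longrightarrow> f x \<noteq> f y)"

lemma colors_outside_insert:
  assumes "proper_coloring G \<phi>" and "colors_outside G \<phi> (insert c S) X n f"
  shows "colors_outside G \<phi> S X (Suc n) (\<lambda>x. if \<phi> x = c then n else f x)"
  using assms unfolding colors_outside_def proper_coloring_def
  by (auto simp: less_Suc_eq) (metis less_irrefl)+

lemma colors_outside_mono:
  "colors_outside G \<phi> S X m f \<Longrightarrow> Y \<subseteq> X \<Longrightarrow> m \<le> n \<Longrightarrow> colors_outside G \<phi> S Y n f"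
  unfolding colors_outside_def by (meson order_less_le_trans subsetD)

text \<open>The connected component of \<open>x\<close> in the subgraph induced on \<open>Y\<close>;
  it is empty if \<open>x\<close> is not in \<open>Y\<close>.\<close>

definition comp_in :: "('a, 'b) pre_digraph \<Rightarrow> 'a set \<Rightarrow> 'a \<Rightarrow> 'a set" where
  "comp_in G Y x = {y. (x, y) \<in> rtrancl_on Y (arcs_ends G)}"

lemma comp_in_subset: "comp_in G Y x \<subseteq> Y"
  by (auto simp: comp_in_def dest: in_rtrancl_on_in_F)

lemma comp_in_self: "x \<in> Y \<Longrightarrow> x \<in> comp_in G Y x"
  by (simp add: comp_in_def)

lemma comp_in_eq:
  assumes "graph G" and "y \<in> comp_in G Y x"
  shows "comp_in G Y y = comp_in G Y x"
proof -
  interpret graph G by fact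
  have "sym (arcs_ends G)"
    using sym_arcs by (simp add: symmetric_def)
  then have "sym (rtrancl_on Y (arcs_ends G))"
    by (rule rtrancl_on_sym)
  with assms(2) show ?thesis
    unfolding comp_in_def by (auto dest: symD intro: rtrancl_on_trans)
qed

lemma comp_in_adj:
  assumes "graph G" "x \<in> Y" "y \<in> Y" "x \<rightarrow>\<^bsub>G\<^esub> y"
  shows "comp_in G Y y = comp_in G Y x"
  using assms(2-) by (intro comp_in_eq[OF assms(1)])
    (auto simp: comp_in_def intro: rtrancl_on_into_rtrancl_on)

text \<open>A walk inside \<open>Y\<close> from \<open>y\<close> never leaves the component, so it
  survives in every \<open>X\<close> containing the component. With \<open>X = insert u D\<close>
  this restores the connectivity needed for the induction.\<close>

lemma comp_in_connected:
  assumes "graph G" "x \<in> Y" "y \<in> comp_in G Y x" "z \<in> comp_in G Y x"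
    "comp_in G Y x \<subseteq> X"
  shows "(y, z) \<in> rtrancl_on X (arcs_ends G)"
proof -
  have eq: "comp_in G Y y = comp_in G Y x"
    using assms(1,3) by (rule comp_in_eq)
  have "(y, z) \<in> rtrancl_on Y (arcs_ends G)"
    using assms(4) eq by (auto simp: comp_in_def)
  then show ?thesis
  proof (induction rule: rtrancl_on_induct)
    case base
    then show ?case using assms(3,5) by auto
  next
    case (step b c)
    have "c \<in> comp_in G Y y"
      using step unfolding comp_in_def by (auto intro: rtrancl_on_into_rtrancl_on)
    then show ?case
      using step eq assms(5) by (auto intro: rtrancl_on_into_rtrancl_on)
  qed
qed

text \<open>On a walk from \<open>v\<close> to \<open>x\<close>, take for \<open>u\<close> the last
  vertex outside \<open>Y\<close>. It is not \<open>v\<close>, since its successor lies in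
  \<open>Y\<close> and so is not adjacent to \<open>v\<close>.\<close>

lemma comp_in_attached:
  assumes "graph G" and "(v, x) \<in> rtrancl_on X (arcs_ends G)"
    and Y: "Y = {y \<in> X. y \<noteq> v \<and> \<not> v \<rightarrow>\<^bsub>G\<^esub> y}" and "x \<in> Y"
  shows "\<exists>u y. u \<in> X \<and> v \<rightarrow>\<^bsub>G\<^esub> u \<and> u \<rightarrow>\<^bsub>G\<^esub> y \<and> y \<in> comp_in G Y x"
  using assms(2,4)
proof (induction rule: rtrancl_on_induct)
  case base
  then show ?case using Y by simp
next
  case (step z x)
  show ?case
  proof (cases "z \<in> Y")
    case True
    then show ?thesis
      using step comp_in_adj[OF assms(1), of z Y x] by auto
  next
    case False
    then have "v \<rightarrow>\<^bsub>G\<^esub> z"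
      using step Y by auto
    then show ?thesis
      using step comp_in_self[of x Y G] by blast
  qed
qed

lemma colors_outside_if_few_new_colors:
  fixes G :: "('a, 'b) pre_digraph" and \<phi> :: "'a \<Rightarrow> 'c"
  assumes "graph G" and tf: "triangle_free G" and pc: "proper_coloring G \<phi>"
    and "X \<subseteq> verts G" "v \<in> X" "\<phi> v \<in> S"
    and "\<And>x. x \<in> X \<Longrightarrow> (v, x) \<in> rtrancl_on X (arcs_ends G)"
    and "\<And>p. induced_path G p \<Longrightarrow> hd p = v \<Longrightarrow> set p \<subseteq> X \<Longrightarrow> card (\<phi> ` set p - S) \<le> k"
  shows "\<exists>f. colors_outside G \<phi> S X (2 * k) f"
  using assms(4-)
\<comment> \<open>\<open>k\<close> drops only when the path moves on to a new color, whereas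
  \<open>X\<close> always loses \<open>v\<close>.\<close>
proof (induction "card X" arbitrary: X v S k rule: less_induct)
  case less
  note IH = less.hyps and XV = less.prems(1) and vX = less.prems(2) and vS = less.prems(3)
    and conn = less.prems(4) and few = less.prems(5)
  interpret graph G by fact
  have finX: "finite X"
    using XV finite_verts finite_subset by blast
  have sym: "a \<rightarrow>\<^bsub>G\<^esub> b \<Longrightarrow> b \<rightarrow>\<^bsub>G\<^esub> a" for a b
    by (rule arcs_ends_symmetric[OF sym_arcs])
  define Y where "Y = {y \<in> X. y \<noteq> v \<and> \<not> v \<rightarrow>\<^bsub>G\<^esub> y}"
  define B where "B = {u \<in> X. v \<rightarrow>\<^bsub>G\<^esub> u \<and> \<phi> u \<notin> S}"
  \<comment> \<open>This keeps the natural-number differences \<open>k - 1\<close> and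
    \<open>2 * k - 1\<close> from being truncated when \<open>B\<close> is nonempty.\<close>
  have k_pos: "k > 0" if "u \<in> B" for u
  proof -
    have u: "u \<in> X" "v \<rightarrow>\<^bsub>G\<^esub> u" "\<phi> u \<notin> S"
      using that by (auto simp: B_def)
    have "induced_path G [v, u]"
      using u adj_not_same XV \<open>graph G\<close>
      by (intro induced_path_Cons induced_path_singleton) auto
    then have "card (\<phi> ` set [v, u] - S) \<le> k"
      using u vX by (intro few) auto
    moreover have "\<phi> ` set [v, u] - S = {\<phi> u}"
      using u vS by auto
    ultimately show ?thesis by simp
  qed
  \<comment> \<open>A component touching \<open>B\<close> must leave the color
    \<open>2 * k - 1\<close> free. One \<open>f\<close> meets both bounds, so that a single choice
    \<open>F\<close> can be made below.\<close>
  have comp: "\<exists>f. colors_outside G \<phi> S D (2 * k) f \<and>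
      ((\<exists>u \<in> B. \<exists>y \<in> D. u \<rightarrow>\<^bsub>G\<^esub> y) \<longrightarrow> colors_outside G \<phi> S D (2 * k - 1) f)"
    if D: "D \<in> comp_in G Y ` Y" for D
  proof -
    obtain x where x: "x \<in> Y" "D = comp_in G Y x"
      using D by auto
    have DY: "D \<subseteq> Y"
      using comp_in_subset x(2) by simp
    \<comment> \<open>\<open>D\<close> contains no neighbor of \<open>v\<close>, so \<open>u\<close>
      is the only neighbor of \<open>v\<close> on \<open>p\<close>.\<close>
    have vu_path: "induced_path G (v # p) \<and> set (v # p) \<subseteq> X"
      if "induced_path G p" "hd p = u" "set p \<subseteq> insert u D" "u \<in> X" "v \<rightarrow>\<^bsub>G\<^esub> u" for p u
      using that DY vX adj_not_same \<open>graph G\<close>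
      by (auto simp: Y_def intro!: induced_path_Cons)
    have conn': "(u, z) \<in> rtrancl_on (insert u D) (arcs_ends G)"
      if "y \<in> D" "u \<rightarrow>\<^bsub>G\<^esub> y" "z \<in> insert u D" for u y z
    proof (cases "z = u")
      case False
      then have "(y, z) \<in> rtrancl_on (insert u D) (arcs_ends G)"
        using that x by (intro comp_in_connected[OF \<open>graph G\<close>, of x Y]) auto
      then show ?thesis
        using that by (auto intro: converse_rtrancl_on_into_rtrancl_on)
    qed auto
    have smaller: "card (insert u D) < card X" if "u \<in> X" "v \<rightarrow>\<^bsub>G\<^esub> u" for u
    proof (rule psubset_card_mono[OF finX])
      have "v \<notin> insert u D"
        using that DY adj_not_same by (auto simp: Y_def)
      then show "insert u D \<subset> X"
        using that DY vX by (auto simp: Y_def)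
    qed
    show ?thesis
    proof (cases "\<exists>u \<in> B. \<exists>y \<in> D. u \<rightarrow>\<^bsub>G\<^esub> y")
      case True
      then obtain u y where u: "u \<in> B" "y \<in> D" "u \<rightarrow>\<^bsub>G\<^esub> y" by blast
      then have u': "u \<in> X" "v \<rightarrow>\<^bsub>G\<^esub> u" "\<phi> u \<notin> S"
        by (auto simp: B_def)
      have "\<exists>f. colors_outside G \<phi> (insert (\<phi> u) S) (insert u D) (2 * (k - 1)) f"
      proof (rule IH)
        show "insert u D \<subseteq> verts G"
          using u' DY XV by (auto simp: Y_def)
        fix p assume p: "induced_path G p" "hd p = u" "set p \<subseteq> insert u D"
        have "card (\<phi> ` set (v # p) - S) \<le> k"
          using vu_path[OF p u'(1,2)] by (intro few) auto
        moreover have "u \<in> set p"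
          using p(1,2) by (auto simp: induced_path_def vpath_def vwalk_def)
        \<comment> \<open>The color of \<open>u\<close> counts as new for \<open>S\<close> but not
          for the enlarged set, which lowers the bound by exactly one.\<close>
        then have "\<phi> ` set (v # p) - S = insert (\<phi> u) (\<phi> ` set p - insert (\<phi> u) S)"
          using u' vS by auto
        ultimately show "card (\<phi> ` set p - insert (\<phi> u) S) \<le> k - 1"
          by simp
      qed (use smaller[OF u'(1,2)] conn'[OF u(2,3)] in auto)
      then obtain f where f: "colors_outside G \<phi> (insert (\<phi> u) S) (insert u D) (2 * (k - 1)) f"
        by blast
      have "Suc (2 * (k - 1)) = 2 * k - 1"
        using k_pos[OF u(1)] by simp
      then have "\<exists>g. colors_outside G \<phi> S (insert u D) (2 * k - 1) g"
        using colors_outside_insert[OF pc f] by auto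
      then show ?thesis
        by (meson colors_outside_mono diff_le_self order_refl subset_insertI)
    next
      case False
      \<comment> \<open>Connectivity of \<open>X\<close> supplies a neighbor of \<open>v\<close>
        attached to \<open>D\<close>; in this case its color is old, so \<open>S\<close> and
        \<open>k\<close> stay the same.\<close>
      obtain u y where u: "u \<in> X" "v \<rightarrow>\<^bsub>G\<^esub> u" "u \<rightarrow>\<^bsub>G\<^esub> y" "y \<in> D"
        using comp_in_attached[OF \<open>graph G\<close> conn Y_def x(1)] x Y_def by auto
      then have uS: "\<phi> u \<in> S"
        using False by (auto simp: B_def)
      have "\<exists>f. colors_outside G \<phi> S (insert u D) (2 * k) f"
      proof (rule IH)
        show "insert u D \<subseteq> verts G"
          using u DY XV by (auto simp: Y_def)
        fix p assume p: "induced_path G p" "hd p = u" "set p \<subseteq> insert u D"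
        have "card (\<phi> ` set (v # p) - S) \<le> k"
          using vu_path[OF p u(1,2)] by (intro few) auto
        then show "card (\<phi> ` set p - S) \<le> k"
          using vS by simp
      qed (use smaller[OF u(1,2)] conn'[OF u(4,3)] uS in auto)
      then show ?thesis
        using False colors_outside_mono by (metis order_refl subset_insertI)
    qed
  qed
  obtain F where F: "\<And>D. D \<in> comp_in G Y ` Y \<Longrightarrow> colors_outside G \<phi> S D (2 * k) (F D)"
    and F': "\<And>D u y. D \<in> comp_in G Y ` Y \<Longrightarrow> u \<in> B \<Longrightarrow> y \<in> D \<Longrightarrow> u \<rightarrow>\<^bsub>G\<^esub> y \<Longrightarrow>
      colors_outside G \<phi> S D (2 * k - 1) (F D)"
    using comp by metis
  define f where "f x = (if x \<in> B then 2 * k - 1 else F (comp_in G Y x) x)" for x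
  \<comment> \<open>Neither \<open>v\<close> nor its old-colored neighbors need a color.\<close>
  have cases: "x \<in> B \<or> x \<in> Y \<and> x \<notin> B" if "x \<in> X" "\<phi> x \<notin> S" for x
    using that vS by (auto simp: B_def Y_def)
  have BB: "\<not> x \<rightarrow>\<^bsub>G\<^esub> y" if "x \<in> B" "y \<in> B" for x y
    using that tf sym unfolding triangle_free_def B_def by blast
  have BY: "f y < 2 * k - 1" if "x \<in> B" "y \<in> Y" "y \<notin> B" "\<phi> y \<notin> S" "x \<rightarrow>\<^bsub>G\<^esub> y" for x y
    using F'[of "comp_in G Y y" x y] that comp_in_self[of y Y G]
    by (auto simp: f_def colors_outside_def)
  \<comment> \<open>Adjacent vertices of \<open>Y\<close> share a component, hence the same coloring
    from \<open>F\<close>.\<close>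
  have YY: "f x \<noteq> f y"
    if "x \<in> Y" "x \<notin> B" "y \<in> Y" "y \<notin> B" "\<phi> x \<notin> S" "\<phi> y \<notin> S" "x \<rightarrow>\<^bsub>G\<^esub> y" for x y
    using F[of "comp_in G Y x"] that comp_in_self[of x Y G] comp_in_self[of y Y G]
      comp_in_adj[OF \<open>graph G\<close>, of x Y y]
    by (auto simp: f_def colors_outside_def)
  have fB: "f x = 2 * k - 1" if "x \<in> B" for x
    using that by (simp add: f_def)
  have "f x < 2 * k" if "x \<in> X" "\<phi> x \<notin> S" for x
  proof (cases "x \<in> B")
    case True
    then show ?thesis using fB k_pos by fastforce
  next
    case False
    then show ?thesis
      using cases[OF that] F[of "comp_in G Y x"] comp_in_self[of x Y G] that
      by (auto simp: f_def colors_outside_def)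
  qed
  moreover have "f x \<noteq> f y" if "x \<in> X" "y \<in> X" "\<phi> x \<notin> S" "\<phi> y \<notin> S" "x \<rightarrow>\<^bsub>G\<^esub> y" for x y
    using cases[OF that(1,3)] cases[OF that(2,4)] BB BY YY fB that sym
    by (metis less_irrefl)
  ultimately show ?case
    unfolding colors_outside_def by blast
qed

theorem theorem2:
  fixes G :: "('a, 'b) pre_digraph" and \<phi> :: "'a \<Rightarrow> 'c"
  assumes "graph G"
    and "Digraph_Component.connected G"
    and "triangle_free G"
    and "proper_coloring G \<phi>"
  shows "\<forall>v \<in> verts G. \<exists>p. induced_path G p \<and> hd p = v \<and>
           real (card (\<phi> ` set p)) \<ge> real (chromatic_number G) / 2"
proof (rule ballI, rule ccontr)
  fix v assume v: "v \<in> verts G"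
    and no_path: "\<not> (\<exists>p. induced_path G p \<and> hd p = v \<and>
           real (card (\<phi> ` set p)) \<ge> real (chromatic_number G) / 2)"
  interpret graph G by fact
  define n where "n = chromatic_number G"
  \<comment> \<open>At most \<open>(n - 1) div 2\<close> colors occur on a path from
    \<open>v\<close>, one of them the color of \<open>v\<close>. As \<open>n > 2\<close>, the
    subtraction is not truncated and \<open>2 * k + 1 < n\<close>.\<close>
  define k where "k = (n - 1) div 2 - 1"
  have few: "2 * card (\<phi> ` set p) < n" if "induced_path G p" "hd p = v" for p
    using no_path that unfolding n_def by force
  have n: "n > 2"
    using few[OF induced_path_singleton[OF \<open>graph G\<close> v]] by simp
  have "\<exists>f. colors_outside G \<phi> {\<phi> v} (verts G) (2 * k) f"
  proof (rule colors_outside_if_few_new_colors[where v = v])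
    fix x assume "x \<in> verts G"
    \<comment> \<open>\<open>connected\<close> speaks of the symmetric closure, which has the same
      reachability since the arcs are symmetric.\<close>
    then show "(v, x) \<in> rtrancl_on (verts G) (arcs_ends G)"
      using \<open>Digraph_Component.connected G\<close> v reachable_mk_symmetric_eq[OF sym_arcs]
      by (auto simp: connected_def strongly_connected_def reachable_def)
  next
    fix p assume p: "induced_path G p" "hd p = v"
    then have "v \<in> set p"
      by (auto simp: induced_path_def vpath_def vwalk_def)
    then have "card (\<phi> ` set p - {\<phi> v}) = card (\<phi> ` set p) - 1"
      by simp
    then show "card (\<phi> ` set p - {\<phi> v}) \<le> k"
      using few[OF p] unfolding k_def by linarith
  qed (use assms v in auto)
  then obtain f where "colors_outside G \<phi> {\<phi> v} (verts G) (2 * k) f"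
    by blast
  from colors_outside_insert[OF \<open>proper_coloring G \<phi>\<close> this]
  obtain g where g: "colors_outside G \<phi> {} (verts G) (Suc (2 * k)) g"
    by blast
  have "proper_coloring G g \<and> g ` verts G \<subseteq> {..<Suc (2 * k)}"
    using g adj_in_verts unfolding colors_outside_def proper_coloring_def by blast
  then have "n \<le> Suc (2 * k)"
    unfolding n_def chromatic_number_def by (intro Least_le) blast
  then show False
    using n unfolding k_def by linarith
qed

end
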